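(* Let $\mathcal{P}(\mathbb{N})$ be Scott's graph model and $C(A)=\mathbb{N}-A$ the complement function on it. The only repcon topologies for the pca $\mathcal{P}(\mathbb{N})[C]$ are the trivial ones (the discrete and the indiscrete topology).
   Context: A partial combinatory algebra (pca) is a set $\mathcal{A}$ with a partial binary application $(a,b)\mapsto ab$ (associating to the left) such that there are $\mathsf{k},\mathsf{s}\in\mathcal{A}$ with, for all $a,b,c$: $\mathsf{k}ab=a$; $\mathsf{s}ab$ is defined; and whenever $(ac)(bc)$ is defined, $\mathsf{s}abc$ is defined and equals $(ac)(bc)$. A partial function $f:\mathcal{A}\to\mathcal{A}$ is representable in $\mathcal{A}$ if there is $a_f\in\mathcal{A}$ with $a_fa=f(a)$ for all $a$ in the domain of $f$. A topology on a pca $\mathcal{A}$ is repcon if every partial representable function $\mathcal{A}\to\mathcal{A}$ is continuous on its domain (as subspace of $\mathcal{A}$). Every pca contains booleans $\mathsf{T},\mathsf{F}$ with a definition-by-cases element $D$ ($D\mathsf{T}ab=a$, $D\mathsf{F}ab=b$), and standard codings $[a,b]$ of pairs and $[a_0,\ldots,a_{n-1}]$ of finite sequences whose basic operations (length, projections, appending) are representable; fix such choices. For a pca $\mathcal{A}$ and a partial function $f:\mathcal{A}\to\mathcal{A}$, $\mathcal{A}[f]$ is the pca with underlying set $\mathcal{A}$ and application $\cdot_f$ defined by: $a\cdot_f b=c$ iff there is a finite sequence $e_0,\ldots,e_{n-1}$ in $\mathcal{A}$ (on each of which $f$ is defined) such that $a[b,f(e_0),\ldots,f(e_{i-1})]=[\mathsf{F},e_i]$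 for all $i<n$ and $a[b,f(e_0),\ldots,f(e_{n-1})]=[\mathsf{T},c]$. (It is known that this is a pca, that $f$ is representable in it, and that application of $\mathcal{A}$ is representable in it.) Scott's graph model is the set $\mathcal{P}(\mathbb{N})$ of subsets of $\mathbb{N}$ with application $A\circ B=\{n\mid \exists m\,([m,n]\in A,\ e_m\subseteq B)\}$, where $[\cdot,\cdot]$ is a standard bijective pairing on $\mathbb{N}$ and $e_k$ is the finite set $p$ with $k=\sum_{i\in p}2^i$. *)

theory Defs
  imports "HOL-Analysis.Abstract_Topology" "HOL-Library.Nat_Bijection"
begin

section \<open>Partial combinatory algebras\<close>

text \<open>
  A partial applicative structure lives on a whole type and is given by its partial application
  \<open>app :: 'a \<Rightarrow> 'a \<rightharpoonup> 'a\<close>, where \<open>None\<close> means undefined.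
\<close>

fun apps :: "('a \<Rightarrow> 'a \<rightharpoonup> 'a) \<Rightarrow> 'a \<Rightarrow> 'a list \<rightharpoonup> 'a" where
  "apps app a [] = Some a"
| "apps app a (b # bs) = Option.bind (app a b) (\<lambda>c. apps app c bs)"

definition pca :: "('a \<Rightarrow> 'a \<rightharpoonup> 'a) \<Rightarrow> bool" where
  "pca app \<longleftrightarrow> (\<exists>k s.
     (\<forall>a b. apps app k [a, b] = Some a) \<and>
     (\<forall>a b. apps app s [a, b] \<noteq> None) \<and>
     (\<forall>a b c x y z. app a c = Some x \<and> app b c = Some y \<and> app x y = Some z \<longrightarrow>
        apps app s [a, b, c] = Some z))"

text \<open>A representing element may be defined outside the domain of the function it represents.\<close>

definition representable :: "('a \<Rightarrow> 'a \<rightharpoonup> 'a) \<Rightarrow> ('a \<rightharpoonup> 'a) \<Rightarrow> bool" where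
  "representable app f \<longleftrightarrow> (\<exists>a. \<forall>x y. f x = Some y \<longrightarrow> app a x = Some y)"

definition repcon :: "('a \<Rightarrow> 'a \<rightharpoonup> 'a) \<Rightarrow> 'a topology \<Rightarrow> bool" where
  "repcon app X \<longleftrightarrow> topspace X = UNIV \<and>
     (\<forall>f. representable app f \<longrightarrow>
        continuous_map (subtopology X (dom f)) X (\<lambda>x. the (f x)))"

section \<open>Codings\<close>

record 'a coding =
  tt :: 'a
  ff :: 'a
  pair :: "'a \<Rightarrow> 'a \<Rightarrow> 'a"
  num :: "nat \<Rightarrow> 'a"
  seq :: "'a list \<Rightarrow> 'a"

text \<open>
  The choice of booleans, pairs and sequences is left open, subject to the requirement that their
  basic operations are representable. Lengths and indices of sequences are elements of the algebra,
  so numerals are part of the choice as well.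
\<close>

definition is_coding :: "('a \<Rightarrow> 'a \<rightharpoonup> 'a) \<Rightarrow> 'a coding \<Rightarrow> bool" where
  "is_coding app K \<longleftrightarrow>
     (\<exists>d. \<forall>a b. apps app d [tt K, a, b] = Some a \<and> apps app d [ff K, a, b] = Some b) \<and>
     (\<exists>p. \<forall>a b. apps app p [a, b] = Some (pair K a b)) \<and>
     (\<exists>p. \<forall>a b. app p (pair K a b) = Some a) \<and>
     (\<exists>p. \<forall>a b. app p (pair K a b) = Some b) \<and>
     (\<exists>z. app z (num K 0) = Some (tt K) \<and> (\<forall>n. app z (num K (Suc n)) = Some (ff K))) \<and>
     (\<exists>s. \<forall>n. app s (num K n) = Some (num K (Suc n))) \<and>
     (\<exists>p. \<forall>n. app p (num K (Suc n)) = Some (num K n)) \<and>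
     (\<exists>l. \<forall>as. app l (seq K as) = Some (num K (length as))) \<and>
     (\<exists>p. \<forall>as. \<forall>i<length as. apps app p [num K i, seq K as] = Some (as ! i)) \<and>
     (\<exists>p. \<forall>as a. apps app p [seq K as, a] = Some (seq K (as @ [a])))"

section \<open>Adjoining a partial function\<close>

definition computes_with ::
    "('a \<Rightarrow> 'a \<rightharpoonup> 'a) \<Rightarrow> 'a coding \<Rightarrow> ('a \<rightharpoonup> 'a) \<Rightarrow> 'a \<Rightarrow> 'a \<Rightarrow> 'a \<Rightarrow> bool" where
  "computes_with app K f a b c \<longleftrightarrow> (\<exists>es. set es \<subseteq> dom f \<and>
     (\<forall>i<length es. app a (seq K (b # map (\<lambda>e. the (f e)) (take i es)))
                     = Some (pair K (ff K) (es ! i))) \<and>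
     app a (seq K (b # map (\<lambda>e. the (f e)) es)) = Some (pair K (tt K) c))"

definition adjoin ::
    "('a \<Rightarrow> 'a \<rightharpoonup> 'a) \<Rightarrow> 'a coding \<Rightarrow> ('a \<rightharpoonup> 'a) \<Rightarrow> 'a \<Rightarrow> 'a \<rightharpoonup> 'a" where
  "adjoin app K f a b =
     (if \<exists>c. computes_with app K f a b c then Some (THE c. computes_with app K f a b c) else None)"

text \<open>The result of a computation is unique, so the description operator above is harmless.\<close>

lemma computes_with_unique:
  assumes K: "is_coding app K"
    and 1: "computes_with app K f a b c" and 2: "computes_with app K f a b c'"
  shows "c = c'"
proof -
  obtain p q d where p: "\<And>a b. app p (pair K a b) = Some a" and q: "\<And>a b. app q (pair K a b) = Some b"
    and d: "\<And>a b. apps app d [tt K, a, b] = Some a" "\<And>a b. apps app d [ff K, a, b] = Some b"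
    using K unfolding is_coding_def by (elim conjE exE) (rule that; blast)
  have inj: "x = x' \<and> y = y'" if "pair K x y = pair K x' y'" for x y x' y'
    using that p[of x y] p[of x' y'] q[of x y] q[of x' y'] by simp
  have tf: "x = y" if "tt K = ff K" for x y :: 'a
    using that d(1)[of x y] d(2)[of x y] by (simp del: apps.simps)
  let ?g = "\<lambda>es. seq K (b # map (\<lambda>e. the (f e)) es)"
  obtain es where es: "\<And>i. i < length es \<Longrightarrow> app a (?g (take i es)) = Some (pair K (ff K) (es ! i))"
      "app a (?g es) = Some (pair K (tt K) c)"
    using 1 unfolding computes_with_def by blast
  obtain es' where es': "\<And>i. i < length es' \<Longrightarrow> app a (?g (take i es')) = Some (pair K (ff K) (es' ! i))"
      "app a (?g es') = Some (pair K (tt K) c')"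
    using 2 unfolding computes_with_def by blast
  have agree: "take i es = take i es'" if "i \<le> length es" "i \<le> length es'" for i
    using that
  proof (induction i)
    case (Suc i)
    then have "pair K (ff K) (es ! i) = pair K (ff K) (es' ! i)"
      using es(1)[of i] es'(1)[of i] by simp
    then have "es ! i = es' ! i" using inj by blast
    then show ?case using Suc by (simp add: take_Suc_conv_app_nth)
  qed simp
  consider "length es < length es'" | "length es' < length es" | "length es = length es'" by linarith
  then show ?thesis
  proof cases
    case 1
    then have "pair K (tt K) c = pair K (ff K) (es' ! length es)"
      using agree[of "length es"] es(2) es'(1)[of "length es"] by simp
    then show ?thesis using inj tf by blast
  next
    case 2
    then have "pair K (tt K) c' = pair K (ff K) (es ! length es')"
      using agree[of "length es'"] es'(2) es(1)[of "length es'"] by simp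
    then show ?thesis using inj tf by blast
  next
    case 3
    then have "es = es'" using agree[of "length es"] by simp
    then have "pair K (tt K) c = pair K (tt K) c'" using es(2) es'(2) by simp
    then show ?thesis using inj by blast
  qed
qed

lemma adjoin_eq_Some_iff:
  assumes "is_coding app K"
  shows "adjoin app K f a b = Some c \<longleftrightarrow> computes_with app K f a b c"
proof -
  have "(THE c. computes_with app K f a b c) = c" if "computes_with app K f a b c" for c
    using that computes_with_unique[OF assms] by (intro the_equality) blast+
  then show ?thesis unfolding adjoin_def by (cases "\<exists>c. computes_with app K f a b c") auto
qed

section \<open>Scott's graph model\<close>

text \<open>
  \<^const>\<open>set_decode\<close> enumerates the finite sets of naturals by binary expansion: it is the inverse
  of \<^const>\<open>set_encode\<close>, which maps a finite set to the sum of the corresponding powers of two.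
\<close>

definition graph_ap :: "nat set \<Rightarrow> nat set \<Rightarrow> nat set" where
  "graph_ap A B = {n. \<exists>m. prod_encode (m, n) \<in> A \<and> set_decode m \<subseteq> B}"

definition graph_app :: "nat set \<Rightarrow> nat set \<rightharpoonup> nat set" where
  "graph_app A B = Some (graph_ap A B)"

definition complement_fun :: "nat set \<rightharpoonup> nat set" where
  "complement_fun A = Some (UNIV - A)"

subsection \<open>The graph model is a pca and admits a coding\<close>

text \<open>Predicates determined by a finite part of their argument.\<close>

definition finitary :: "(nat set \<Rightarrow> bool) \<Rightarrow> bool" where
  "finitary P \<longleftrightarrow> (\<forall>B. P B \<longleftrightarrow> (\<exists>p. finite p \<and> p \<subseteq> B \<and> P p))"

definition graph_lam :: "(nat set \<Rightarrow> nat set) \<Rightarrow> nat set" where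
  "graph_lam F = {prod_encode (m, n) | m n. n \<in> F (set_decode m)}"

lemma finitary_mono: "finitary P \<Longrightarrow> P A \<Longrightarrow> A \<subseteq> B \<Longrightarrow> P B"
  unfolding finitary_def by (metis order_trans)

lemma finitary_finite: "finitary P \<Longrightarrow> P B \<Longrightarrow> \<exists>p. finite p \<and> p \<subseteq> B \<and> P p"
  unfolding finitary_def by blast

lemma finitaryI:
  assumes "\<And>A B. A \<subseteq> B \<Longrightarrow> P A \<Longrightarrow> P B" "\<And>B. P B \<Longrightarrow> \<exists>p. finite p \<and> p \<subseteq> B \<and> P p"
  shows "finitary P"
  unfolding finitary_def
proof (intro allI iffI)
  fix B assume "\<exists>p. finite p \<and> p \<subseteq> B \<and> P p"
  then obtain p where "p \<subseteq> B" "P p" by blast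
  then show "P B" by (rule assms(1))
qed (rule assms(2))

lemma finitary_mem: "finitary (\<lambda>x. n \<in> x)"
proof (rule finitaryI)
  fix B assume "n \<in> B"
  then show "\<exists>p. finite p \<and> p \<subseteq> B \<and> n \<in> p" by (intro exI[of _ "{n}"]) simp
qed blast

lemma finitary_const: "finitary (\<lambda>x. c)"
  by (rule finitaryI) (assumption, rule exI[of _ "{}"], simp)

lemma finitary_conj:
  assumes "finitary P" "finitary Q" shows "finitary (\<lambda>x. P x \<and> Q x)"
proof (rule finitaryI)
  fix B assume "P B \<and> Q B"
  then obtain p q where "finite p" "p \<subseteq> B" "P p" "finite q" "q \<subseteq> B" "Q q"
    using finitary_finite[OF assms(1), of B] finitary_finite[OF assms(2), of B] by blast
  then show "\<exists>p. finite p \<and> p \<subseteq> B \<and> P p \<and> Q p"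
    using finitary_mono[OF assms(1), of p "p \<union> q"] finitary_mono[OF assms(2), of q "p \<union> q"]
    by (intro exI[of _ "p \<union> q"]) auto
qed (metis assms finitary_mono)

lemma finitary_ex: "(\<And>y. finitary (P y)) \<Longrightarrow> finitary (\<lambda>x. \<exists>y. P y x)"
  by (rule finitaryI) (metis finitary_mono, metis finitary_finite)

lemma finitary_disj: "finitary P \<Longrightarrow> finitary Q \<Longrightarrow> finitary (\<lambda>x. P x \<or> Q x)"
  by (rule finitaryI) (metis finitary_mono, metis finitary_finite)

lemma finitary_subset:
  assumes "\<And>n. finitary (\<lambda>x. n \<in> F x)" "finite p"
  shows "finitary (\<lambda>x. p \<subseteq> F x)"
  using assms(2)
proof induction
  case (insert a p)
  then show ?case using finitary_conj[OF assms(1)[of a] insert(3)] by simp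
qed (simp add: finitary_const)

lemma mem_graph_lam: "z \<in> graph_lam F \<longleftrightarrow> snd (prod_decode z) \<in> F (set_decode (fst (prod_decode z)))"
proof -
  obtain m n where "z = prod_encode (m, n)" by (metis prod_decode_inverse surj_pair)
  then show ?thesis by (simp add: graph_lam_def)
qed

lemma finitary_graph_lam: "(\<And>y n. finitary (\<lambda>x. n \<in> H x y)) \<Longrightarrow> finitary (\<lambda>x. n \<in> graph_lam (H x))"
  by (simp add: mem_graph_lam)

lemma finitary_graph_ap:
  assumes "\<And>n. finitary (\<lambda>x. n \<in> F x)" "\<And>n. finitary (\<lambda>x. n \<in> G x)"
  shows "finitary (\<lambda>x. n \<in> graph_ap (F x) (G x))"
  unfolding graph_ap_def
  by (auto intro!: finitary_ex finitary_conj finitary_subset assms)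

lemma graph_ap_lam:
  assumes "\<And>n. finitary (\<lambda>x. n \<in> F x)"
  shows "graph_ap (graph_lam F) B = F B"
proof (intro set_eqI iffI)
  fix n assume "n \<in> graph_ap (graph_lam F) B"
  then show "n \<in> F B"
    using finitary_mono[OF assms] by (auto simp: graph_ap_def mem_graph_lam)
next
  fix n assume "n \<in> F B"
  then obtain p where "finite p" "p \<subseteq> B" "n \<in> F p" using finitary_finite[OF assms] by blast
  then show "n \<in> graph_ap (graph_lam F) B"
    by (auto simp: graph_ap_def mem_graph_lam intro!: exI[of _ "set_encode p"])
qed

lemmas finitary_intros = finitary_mem finitary_const finitary_conj finitary_disj finitary_ex
  finitary_graph_lam finitary_graph_ap

lemma apps_graph_app:
  "apps graph_app a [] = Some a" "apps graph_app a (b # bs) = apps graph_app (graph_ap a b) bs"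
  by (simp_all add: graph_app_def)

lemma pca_graph_app: "pca graph_app"
proof -
  define k where "k = graph_lam (\<lambda>a. graph_lam (\<lambda>b. a))"
  define s where
    "s = graph_lam (\<lambda>a. graph_lam (\<lambda>b. graph_lam (\<lambda>c. graph_ap (graph_ap a c) (graph_ap b c))))"
  have "graph_ap (graph_ap k a) b = a" for a b
    unfolding k_def by (subst graph_ap_lam, intro finitary_intros)+ (rule refl)
  moreover have "graph_ap (graph_ap (graph_ap s a) b) c = graph_ap (graph_ap a c) (graph_ap b c)" for a b c
    unfolding s_def by (subst graph_ap_lam, intro finitary_intros)+ (rule refl)
  ultimately show ?thesis
    unfolding pca_def by (intro exI[of _ k] exI[of _ s]) (auto simp: graph_app_def)
qed

lemma ex_graph1:
  assumes "\<And>n. finitary (\<lambda>x. n \<in> F x)"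
  shows "\<exists>p. \<forall>x. graph_app p x = Some (F x)"
  using graph_ap_lam[OF assms] by (auto simp: graph_app_def)

lemma ex_graph2:
  assumes "\<And>n y. finitary (\<lambda>x. n \<in> F x y)" "\<And>n x. finitary (\<lambda>y. n \<in> F x y)"
  shows "\<exists>p. \<forall>x y. apps graph_app p [x, y] = Some (F x y)"
proof -
  have "graph_ap (graph_ap (graph_lam (\<lambda>x. graph_lam (F x))) x) y = F x y" for x y
    by (subst graph_ap_lam, intro finitary_intros assms)+ (rule refl)
  then show ?thesis by (intro exI[of _ "graph_lam (\<lambda>x. graph_lam (F x))"]) (simp add: graph_app_def)
qed

lemma ex_graph3:
  assumes "\<And>n y z. finitary (\<lambda>x. n \<in> F x y z)" "\<And>n x z. finitary (\<lambda>y. n \<in> F x y z)"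
    "\<And>n x y. finitary (\<lambda>z. n \<in> F x y z)"
  shows "\<exists>p. \<forall>x y z. apps graph_app p [x, y, z] = Some (F x y z)"
proof -
  have "graph_ap (graph_ap (graph_ap (graph_lam (\<lambda>x. graph_lam (\<lambda>y. graph_lam (F x y)))) x) y) z = F x y z"
    for x y z
    by (subst graph_ap_lam, intro finitary_intros assms)+ (rule refl)
  then show ?thesis by (intro exI[of _ "graph_lam (\<lambda>x. graph_lam (\<lambda>y. graph_lam (F x y)))"]) (simp add: graph_app_def)
qed

lemma ex_is_coding_graph_app: "\<exists>K. is_coding graph_app K"
proof -
  define sq :: "nat set list \<Rightarrow> nat set" where
    "sq as = insert (prod_encode (0, length as))
               {prod_encode (Suc i, k) | i k. i < length as \<and> k \<in> as ! i}" for as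
  have sq0: "prod_encode (0, n) \<in> sq as \<longleftrightarrow> n = length as"
    and sqS: "prod_encode (Suc i, n) \<in> sq as \<longleftrightarrow> i < length as \<and> n \<in> as ! i" for i n as
    by (auto simp: sq_def)
  define K :: "nat set coding" where
    "K = \<lparr>tt = {0}, ff = {1},
          pair = \<lambda>a b. {z. \<exists>n. z = 2 * n \<and> n \<in> a \<or> z = 2 * n + 1 \<and> n \<in> b},
          num = \<lambda>n. {n}, seq = sq\<rparr>"
  define ap where "ap s a = {z. \<exists>n. prod_encode (0, n) \<in> s \<and>
       (z = prod_encode (0, Suc n) \<or> (\<exists>k. k \<in> a \<and> z = prod_encode (Suc n, k)) \<or>
        (\<exists>i k. z = prod_encode (Suc i, k) \<and> z \<in> s))}" for s a
  have d: "\<exists>d. \<forall>x a b. apps graph_app d [x, a, b] = Some {n. 0 \<in> x \<and> n \<in> a \<or> 1 \<in> x \<and> n \<in> b}"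
    by (rule ex_graph3; unfold mem_Collect_eq; intro finitary_intros)
  have pr: "\<exists>p. \<forall>a b. apps graph_app p [a, b] = Some (pair K a b)"
    unfolding K_def coding.simps
    by (rule ex_graph2; unfold mem_Collect_eq; intro finitary_intros)
  have p0: "\<exists>p. \<forall>x. graph_app p x = Some {n. 2 * n \<in> x}"
    by (rule ex_graph1; unfold mem_Collect_eq; intro finitary_intros)
  have p1: "\<exists>p. \<forall>x. graph_app p x = Some {n. 2 * n + 1 \<in> x}"
    by (rule ex_graph1; unfold mem_Collect_eq; intro finitary_intros)
  have z: "\<exists>p. \<forall>x. graph_app p x = Some {z. 0 \<in> x \<and> z = 0 \<or> (\<exists>n. Suc n \<in> x \<and> z = 1)}"
    by (rule ex_graph1; unfold mem_Collect_eq; intro finitary_intros)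
  have s: "\<exists>p. \<forall>x. graph_app p x = Some {z. \<exists>n. n \<in> x \<and> z = Suc n}"
    by (rule ex_graph1; unfold mem_Collect_eq; intro finitary_intros)
  have p: "\<exists>p. \<forall>x. graph_app p x = Some {n. Suc n \<in> x}"
    by (rule ex_graph1; unfold mem_Collect_eq; intro finitary_intros)
  have l: "\<exists>p. \<forall>x. graph_app p x = Some {n. prod_encode (0, n) \<in> x}"
    by (rule ex_graph1; unfold mem_Collect_eq; intro finitary_intros)
  have pj: "\<exists>p. \<forall>i x. apps graph_app p [i, x] = Some {n. \<exists>j. j \<in> i \<and> prod_encode (Suc j, n) \<in> x}"
    by (rule ex_graph2; unfold mem_Collect_eq; intro finitary_intros)
  have ap: "\<exists>p. \<forall>x a. apps graph_app p [x, a] = Some (ap x a)"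
    unfolding ap_def by (rule ex_graph2; unfold mem_Collect_eq; intro finitary_intros)
  have ap_eq: "ap (sq as) a = sq (as @ [a])" for as a
  proof (intro set_eqI)
    fix z obtain j n where z: "z = prod_encode (j, n)" by (metis prod_decode_inverse surj_pair)
    show "z \<in> ap (sq as) a \<longleftrightarrow> z \<in> sq (as @ [a])"
      by (cases j) (auto simp: z ap_def sq0 sqS nth_append less_Suc_eq)
  qed
  have parity: "2 * n = 2 * m + 1 \<longleftrightarrow> False" "2 * n + 1 = 2 * m \<longleftrightarrow> False" for n m :: nat
    by presburger+
  have "is_coding graph_app K"
    unfolding is_coding_def
  proof (intro conjI)
    show "\<exists>d. \<forall>a b. apps graph_app d [tt K, a, b] = Some a \<and> apps graph_app d [ff K, a, b] = Some b"
      using d by (elim ex_forward) (simp add: K_def del: apps.simps)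
    show "\<exists>p. \<forall>a b. graph_app p (pair K a b) = Some a"
      using p0 by (elim ex_forward) (simp add: K_def parity del: One_nat_def)
    show "\<exists>p. \<forall>a b. graph_app p (pair K a b) = Some b"
      using p1 by (elim ex_forward) (simp add: K_def parity del: One_nat_def add_Suc_right)
    show "\<exists>z. graph_app z (num K 0) = Some (tt K) \<and> (\<forall>n. graph_app z (num K (Suc n)) = Some (ff K))"
      using z by (elim ex_forward) (simp add: K_def)
    show "\<exists>s. \<forall>n. graph_app s (num K n) = Some (num K (Suc n))"
      using s by (elim ex_forward) (simp add: K_def)
    show "\<exists>p. \<forall>n. graph_app p (num K (Suc n)) = Some (num K n)"
      using p by (elim ex_forward) (simp add: K_def)
    show "\<exists>l. \<forall>as. graph_app l (seq K as) = Some (num K (length as))"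
      using l by (elim ex_forward) (simp add: K_def sq0)
    show "\<exists>p. \<forall>as. \<forall>i<length as. apps graph_app p [num K i, seq K as] = Some (as ! i)"
      using pj by (elim ex_forward) (simp add: K_def sqS del: apps.simps)
    show "\<exists>p. \<forall>as a. apps graph_app p [seq K as, a] = Some (seq K (as @ [a]))"
      using ap by (elim ex_forward) (simp add: K_def ap_eq del: apps.simps)
  qed (rule pr)
  then show ?thesis ..
qed

end

theory Submission
  imports Defs
begin

text \<open>
  Equality with a fixed set \<open>s\<close> is decidable with the complement as an oracle: \<open>x \<noteq> s\<close> is a
  finitary condition on \<open>x\<close> and \<open>-x\<close>, so a second query turns \<open>x = s\<close> into a finitary
  condition as well. If \<open>U\<close> is open with \<open>a \<in> U\<close> and \<open>b \<notin> U\<close>, the representable function sending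
  \<open>s\<close> to \<open>a\<close> and everything else to \<open>b\<close> pulls \<open>U\<close> back to \<open>{s}\<close>; thus all singletons are open.
\<close>

text \<open>An oracle program of fixed shape: query \<open>x\<close>, query
  \<open>g x (- x)\<close>, then let \<open>r\<close> combine \<open>x\<close> with both answers.
  What remains is to choose \<open>r\<close> and \<open>g\<close> in the graph model.\<close>

lemma adjoin_complement_two_queries:
  assumes K: "is_coding graph_app K"
  shows "\<exists>p. \<forall>x. adjoin graph_app K complement_fun p x =
    Some (graph_ap (graph_ap (graph_ap r x) (- x)) (- graph_ap (graph_ap g x) (- x)))"
proof -
  obtain d q z v l j where
      d: "\<forall>a b. graph_ap (graph_ap (graph_ap d (tt K)) a) b = a \<and>
        graph_ap (graph_ap (graph_ap d (ff K)) a) b = b"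
    and q: "\<forall>a b. graph_ap (graph_ap q a) b = pair K a b"
    and z: "graph_ap z (num K 0) = tt K" "\<forall>n. graph_ap z (num K (Suc n)) = ff K"
    and v: "\<forall>n. graph_ap v (num K (Suc n)) = num K n"
    and l: "\<forall>as. graph_ap l (seq K as) = num K (length as)"
    and j: "\<forall>as. \<forall>i<length as. graph_ap (graph_ap j (num K i)) (seq K as) = as ! i"
    using K unfolding is_coding_def apps_graph_app graph_app_def option.inject
    by (elim conjE exE) (rule that; assumption)
  define nth' where "nth' i w = graph_ap (graph_ap j (num K i)) w" for i w
  \<comment> \<open>Dispatch on the length of \<open>w\<close>, which is 1, 2 or 3 during a run: the
    input heads the sequence, hence one predecessor before the first zero test. Junk in a discarded
    branch, such as the predecessor of zero, is harmless as \<open>graph_ap\<close> is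
    total.\<close>
  define P where "P w = graph_ap (graph_ap (graph_ap d (graph_ap z (graph_ap v (graph_ap l w))))
      (graph_ap (graph_ap q (ff K)) (nth' 0 w)))
      (graph_ap (graph_ap (graph_ap d (graph_ap z (graph_ap v (graph_ap v (graph_ap l w)))))
        (graph_ap (graph_ap q (ff K)) (graph_ap (graph_ap g (nth' 0 w)) (nth' 1 w))))
        (graph_ap (graph_ap q (tt K))
          (graph_ap (graph_ap (graph_ap r (nth' 0 w)) (nth' 1 w)) (nth' 2 w))))" for w
  have P: "graph_ap (graph_lam P) w = P w" for w
    by (rule graph_ap_lam, unfold P_def nth'_def, intro finitary_intros)
  have "computes_with graph_app K complement_fun (graph_lam P) x
      (graph_ap (graph_ap (graph_ap r x) (- x)) (- graph_ap (graph_ap g x) (- x)))" for x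
    unfolding computes_with_def
    \<comment> \<open>The witness lists the queries; \<open>seq\<close> receives their
      complements.\<close>
    by (rule exI[of _ "[x, graph_ap (graph_ap g x) (- x)]"])
      (auto simp: graph_app_def complement_fun_def dom_def P P_def nth'_def l v z d q j
        less_Suc_eq Compl_eq_Diff_UNIV)
  then show ?thesis unfolding adjoin_eq_Some_iff[OF K] by blast
qed

lemma representable_singleton_cases:
  assumes K: "is_coding graph_app K"
  shows "representable (adjoin graph_app K complement_fun) (\<lambda>x. Some (if x = s then a else b))"
proof -
  \<comment> \<open>At \<open>y = - x\<close> this says that the symmetric difference of
    \<open>x\<close> and \<open>s\<close> is inhabited. Membership in \<open>x\<close> and
    \<open>y\<close> occurs only positively, so the condition is finitary.\<close>
  define D where "D x y \<longleftrightarrow> (\<exists>m. m \<in> x \<and> m \<in> - s \<or> m \<in> y \<and> m \<in> s)" for x y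
  have D: "D x (- x) \<longleftrightarrow> x \<noteq> s" for x
    unfolding D_def by auto
  have "\<exists>g. \<forall>x y. apps graph_app g [x, y] = Some {n. D x y}"
    unfolding D_def by (rule ex_graph2; unfold mem_Collect_eq; intro finitary_intros)
  then obtain g where g: "\<And>x y. graph_ap (graph_ap g x) y = {n. D x y}"
    by (auto simp: graph_app_def)
  \<comment> \<open>\<open>g\<close> returns \<open>UNIV\<close> or \<open>{}\<close> according to
    \<open>D\<close>. Its complement, passed as \<open>w\<close>, thus contains 0 exactly when
    \<open>x = s\<close>, and only one disjunct can hold.\<close>
  have "\<exists>r. \<forall>x y w. apps graph_app r [x, y, w] = Some {n. 0 \<in> w \<and> n \<in> a \<or> D x y \<and> n \<in> b}"
    unfolding D_def by (rule ex_graph3; unfold mem_Collect_eq; intro finitary_intros)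
  then obtain r where r: "\<And>x y w. graph_ap (graph_ap (graph_ap r x) y) w =
      {n. 0 \<in> w \<and> n \<in> a \<or> D x y \<and> n \<in> b}"
    by (auto simp: graph_app_def)
  obtain p where "\<And>x. adjoin graph_app K complement_fun p x =
      Some (graph_ap (graph_ap (graph_ap r x) (- x)) (- graph_ap (graph_ap g x) (- x)))"
    using adjoin_complement_two_queries[OF K] by blast
  then have "adjoin graph_app K complement_fun p x = Some (if x = s then a else b)" for x
    by (simp add: r g D)
  then show ?thesis unfolding representable_def by (intro exI[of _ p]) simp
qed

theorem corollary2p2:
  fixes K :: "nat set coding" and X :: "nat set topology"
  assumes "is_coding graph_app K"
    and "topspace X = UNIV"
  shows "repcon (adjoin graph_app K complement_fun) X \<longleftrightarrow>
     X = discrete_topology UNIV \<or> (\<forall>U. openin X U \<longleftrightarrow> U = {} \<or> U = UNIV)"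
proof
  assume rep: "repcon (adjoin graph_app K complement_fun) X"
  have "X = discrete_topology UNIV" if U: "openin X U" "U \<noteq> {}" "U \<noteq> UNIV" for U
  proof -
    obtain a b where ab: "a \<in> U" "b \<notin> U" using U by blast
    have "openin X {s}" for s
    proof -
      \<comment> \<open>The function is total, so the subspace in \<open>repcon_def\<close> is
        \<open>X\<close> itself.\<close>
      have "continuous_map X X (\<lambda>x. if x = s then a else b)"
        using rep representable_singleton_cases[OF assms(1), of s a b]
        unfolding repcon_def by (fastforce simp: dom_def)
      then have "openin X {x \<in> topspace X. (if x = s then a else b) \<in> U}"
        using U(1) by (rule openin_continuous_map_preimage)
      moreover have "{x \<in> topspace X. (if x = s then a else b) \<in> U} = {s}"
        using ab assms(2) by auto
      ultimately show ?thesis by simp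
    qed
    then show ?thesis using assms(2) by (metis discrete_topology_unique)
  qed
  moreover have "openin X {}" "openin X UNIV"
    using openin_topspace[of X] assms(2) by simp_all
  ultimately show "X = discrete_topology UNIV \<or> (\<forall>U. openin X U \<longleftrightarrow> U = {} \<or> U = UNIV)"
    by blast
next
  assume "X = discrete_topology UNIV \<or> (\<forall>U. openin X U \<longleftrightarrow> U = {} \<or> U = UNIV)"
  then show "repcon (adjoin graph_app K complement_fun) X"
  proof
    assume "X = discrete_topology UNIV"
    then show ?thesis
      by (simp add: repcon_def continuous_map_def)
  next
    assume U: "\<forall>U. openin X U \<longleftrightarrow> U = {} \<or> U = UNIV"
    \<comment> \<open>Preimages of \<open>{}\<close> and \<open>UNIV\<close> are empty or
      everything, whatever \<open>h\<close> is.\<close>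
    have "continuous_map Y X h" for Y :: "nat set topology" and h
      unfolding continuous_map_def
    proof (intro conjI allI impI)
      fix V assume "openin X V"
      then have "V = {} \<or> V = UNIV" using U by blast
      then show "openin Y {x \<in> topspace Y. h x \<in> V}" by auto
    qed (simp add: assms(2))
    then show ?thesis
      using assms(2) by (simp add: repcon_def)
  qed
qed

end
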